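(* Let $D$ be a nonempty set, let $F$ be a normed space of functions $f:D\to\mathbb{R}$, let $G$ be a real normed space, and let $S:F\to G$ be a continuous (not necessarily linear) operator. For $x\in D$ let $L_x:F\to\mathbb{R}$, $L_x(f)=f(x)$. Assume that for every integer $n\ge0$, all $x_1,\dots,x_n\in D$ and all $x\in D\setminus\{x_1,\dots,x_n\}$, the functional $L_x$ is discontinuous on the subspace $$F\cap\ker L_{x_1}\cap\ker L_{x_2}\cap\dots\cap\ker L_{x_n}$$ (which is $F$ for $n=0$). Then for all $n\in\mathbb{N}=\{1,2,\dots\}$, $$e_n^{\rm std\text{-}wor}(S)=e_0^{\rm std\text{-}wor}(S)=e_0^{\rm all\text{-}wor}(S).$$
   Context: Let $\Lambda^{\rm std}=\{L_x: x\in D\}$ be the class of function evaluations and $\Lambda^{\rm all}$ the class of all continuous linear functionals $F\to\mathbb{R}$. For a class $\Lambda$ of linear functionals on $F$ and an integer $n\ge0$, an algorithm $A_n:F\to G$ using $n$ functionals from $\Lambda$ is a mapping $A_n(f)=\phi_n(y_1,\dots,y_n)$ with $y_j=L_j(f;y_1,\dots,y_{j-1})$, where $\phi_n:\mathbb{R}^n\to G$ is arbitrary and $L_j(\cdot\,;y_1,\dots,y_{j-1})\in\Lambda$ for all $j$ and all $y_1,\dots,y_{j-1}\in\mathbb{R}$ (adaptive choice of functionals is allowed; for $n=0$, $A_0$ is a constant element of $G$). The worst case error is $e(A_n)=\sup_{\|f\|_F<1}\|S(f)-A_n(f)\|_G\in[0,\infty]$. The $n$th minimal worst case errors $e_n^{\rm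 std\text{-}wor}(S)$ and $e_n^{\rm all\text{-}wor}(S)$ are the infima of $e(A_n)$ over algorithms using $n$ functionals from $\Lambda^{\rm std}$ and from $\Lambda^{\rm all}$, respectively. In particular, $e_0^{\rm all\text{-}wor}(S)=e_0^{\rm std\text{-}wor}(S)=\inf_{g\in G}\sup_{\|f\|_F<1}\|S(f)-g\|_G$. *)

theory Defs
  imports Complex_Main "HOL-Library.Extended_Nonnegative_Real"
begin

text \<open>
  A normed space of real-valued functions on \<open>D\<close> is a real normed space \<open>'f\<close> whose elements
  are identified with functions through the evaluation map \<open>ev f x\<close> (read \<open>f(x)\<close>):
  the vector space operations are pointwise on \<open>D\<close>, and elements with the same values
  on \<open>D\<close> are equal.  Values of \<open>ev f\<close> outside \<open>D\<close> are irrelevant.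
\<close>

definition normed_function_space ::
  "'d set \<Rightarrow> ('f::real_normed_vector \<Rightarrow> 'd \<Rightarrow> real) \<Rightarrow> bool" where
  "normed_function_space D ev \<longleftrightarrow>
     (\<forall>x\<in>D. linear (\<lambda>f. ev f x)) \<and>
     (\<forall>f g. (\<forall>x\<in>D. ev f x = ev g x) \<longrightarrow> f = g)"

definition std_class :: "'d set \<Rightarrow> ('f \<Rightarrow> 'd \<Rightarrow> real) \<Rightarrow> ('f \<Rightarrow> real) set" where
  "std_class D ev = (\<lambda>x f. ev f x) ` D"

definition all_class :: "('f::real_normed_vector \<Rightarrow> real) set" where
  "all_class = {L. linear L \<and> continuous_on UNIV L}"

text \<open>
  In an adaptive choice \<open>L\<close> of functionals, \<open>L [y\<^sub>1, \<dots>, y\<^sub>j\<^sub>-\<^sub>1]\<close> is the \<open>j\<close>-th functional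
  \<open>L\<^sub>j(\<cdot>; y\<^sub>1, \<dots>, y\<^sub>j\<^sub>-\<^sub>1)\<close>; the index \<open>j\<close> is determined by the length of the list.
  \<open>information L n f\<close> is \<open>[y\<^sub>1, \<dots>, y\<^sub>n]\<close>.
\<close>

primrec information :: "(real list \<Rightarrow> 'f \<Rightarrow> real) \<Rightarrow> nat \<Rightarrow> 'f \<Rightarrow> real list" where
  "information L 0 f = []"
| "information L (Suc n) f = information L n f @ [L (information L n f) f]"

definition algorithms :: "('f \<Rightarrow> real) set \<Rightarrow> nat \<Rightarrow> ('f \<Rightarrow> 'g) set" where
  "algorithms \<Lambda> n =
     {A. \<exists>L \<phi>. (\<forall>ys. length ys < n \<longrightarrow> L ys \<in> \<Lambda>) \<and> (\<forall>f. A f = \<phi> (information L n f))}"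

definition worst_case_error ::
  "('f::real_normed_vector \<Rightarrow> 'g::real_normed_vector) \<Rightarrow> ('f \<Rightarrow> 'g) \<Rightarrow> ennreal" where
  "worst_case_error S A = (SUP f\<in>{f. norm f < 1}. ennreal (norm (S f - A f)))"

definition minimal_error ::
  "('f::real_normed_vector \<Rightarrow> real) set \<Rightarrow> nat \<Rightarrow> ('f \<Rightarrow> 'g::real_normed_vector) \<Rightarrow> ennreal" where
  "minimal_error \<Lambda> n S = (INF A\<in>algorithms \<Lambda> n. worst_case_error S A)"

definition e_std ::
  "'d set \<Rightarrow> ('f::real_normed_vector \<Rightarrow> 'd \<Rightarrow> real) \<Rightarrow> nat \<Rightarrow>
     ('f \<Rightarrow> 'g::real_normed_vector) \<Rightarrow> ennreal" where
  "e_std D ev n S = minimal_error (std_class D ev) n S"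

definition e_all :: "nat \<Rightarrow> ('f::real_normed_vector \<Rightarrow> 'g::real_normed_vector) \<Rightarrow> ennreal" where
  "e_all n S = minimal_error all_class n S"

end

theory Submission
  imports Defs "HOL-Analysis.Elementary_Metric_Spaces"
begin

text \<open>
  The kernel of a discontinuous linear functional is dense, so by induction on the number of
  points the functions vanishing at finitely many given points are dense in \<open>F\<close>.  Follow an
  algorithm along the answers \<open>0, \<dots>, 0\<close>: it then asks for fixed points and outputs a fixed \<open>g\<close>.
  Every \<open>f\<close> in the unit ball is a limit of functions in the unit ball vanishing at these points,
  hence by continuity of \<open>S\<close> the constant \<open>g\<close> is at least as good as the algorithm.
\<close>

text \<open>If no such \<open>v\<close> existed, rescaling would bound \<open>L\<close> by 1 on the
  \<open>e\<close>-ball of \<open>V\<close>, and a linear functional bounded on a ball is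
  continuous. Subtracting a multiple of \<open>v\<close> corrects a value of \<open>L\<close> at
  small cost in norm.\<close>

lemma discontinuous_linear_functional_value_one:
  fixes L :: "'f::real_normed_vector \<Rightarrow> real"
  assumes L: "linear L" and V: "subspace V" and disc: "\<not> continuous_on V L" and e: "e > 0"
  shows "\<exists>v\<in>V. norm v < e \<and> L v = 1"
proof (rule ccontr)
  assume none: "\<not> ?thesis"
  have bound: "\<bar>L v\<bar> < 1" if v: "v \<in> V" "norm v < e" for v
  proof (rule ccontr)
    assume ge: "\<not> \<bar>L v\<bar> < 1"
    \<comment> \<open>The factor has modulus at most 1, so normalising the value to 1 keeps the
      vector in the ball.\<close>
    let ?w = "(1 / L v) *\<^sub>R v"
    have "?w \<in> V" using V v(1) by (rule subspace_scale)
    moreover have "norm ?w \<le> norm v"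
      using ge by (simp add: divide_le_eq mult_le_cancel_left1)
    moreover have "L ?w = 1" using ge by (auto simp: linear_scale[OF L])
    ultimately show False using none v(2) by (meson le_less_trans)
  qed
  have "continuous_on V L"
    unfolding continuous_on_iff
  proof (intro ballI allI impI)
    fix f r assume f: "f \<in> V" and r: "(r::real) > 0"
    have "dist (L h) (L f) < r" if h: "h \<in> V" "dist h f < e * r" for h
    proof -
      let ?w = "(1 / r) *\<^sub>R (h - f)"
      have "?w \<in> V" using V f h(1) by (intro subspace_scale subspace_diff)
      moreover have "norm ?w < e" using h(2) r by (simp add: dist_norm pos_divide_less_eq del: scaleR_right_diff_distrib)
      ultimately have "\<bar>L ?w\<bar> < 1" by (rule bound)
      then show ?thesis
        using r by (simp add: linear_scale[OF L] linear_diff[OF L] dist_real_def field_simps)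
    qed
    then show "\<exists>d>0. \<forall>h\<in>V. dist h f < d \<longrightarrow> dist (L h) (L f) < r"
      using e r by (intro exI[of _ "e * r"]) auto
  qed
  with disc show False ..
qed

text \<open>In the induction, an approximation \<open>h\<close> that vanishes on \<open>xs\<close>
  is corrected at the new point \<open>x\<close> by subtracting \<open>ev h x\<close> times a small
  \<open>v\<close> that also vanishes on \<open>xs\<close> and has value 1 at
  \<open>x\<close>.\<close>

lemma dense_vanishing_at_points:
  fixes ev :: "'f::real_normed_vector \<Rightarrow> 'd \<Rightarrow> real"
  assumes lin: "\<And>x. x \<in> D \<Longrightarrow> linear (\<lambda>f. ev f x)"
    and disc: "\<And>xs x. set xs \<subseteq> D \<Longrightarrow> x \<in> D - set xs \<Longrightarrow>
           \<not> continuous_on {f. \<forall>y\<in>set xs. ev f y = 0} (\<lambda>f. ev f x)"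
    and xs: "set xs \<subseteq> D" and e: "e > 0"
  shows "\<exists>h. norm (h - f) < e \<and> (\<forall>y\<in>set xs. ev h y = 0)"
  using xs e
proof (induction xs arbitrary: e)
  case Nil
  then show ?case by (intro exI[of _ f]) auto
next
  case (Cons x xs)
  show ?case
  \<comment> \<open>An algorithm may query a point twice, while discontinuity is assumed only at
    points outside \<open>xs\<close>.\<close>
  proof (cases "x \<in> set xs")
    case True
    with Cons show ?thesis by (simp add: insert_absorb)
  next
    case False
    let ?V = "{f. \<forall>y\<in>set xs. ev f y = 0}"
    from Cons.prems have x: "x \<in> D" and xs: "set xs \<subseteq> D" by auto
    have V: "subspace ?V"
      using xs linear_0[OF lin] linear_add[OF lin] linear_scale[OF lin]
      by (auto simp: subspace_def subset_iff)
    from Cons.IH[OF xs, of "e / 2"] Cons.prems obtain h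
      where h: "norm (h - f) < e / 2" "h \<in> ?V" by auto
    \<comment> \<open>Chosen so that the correction costs at most \<open>e / 2\<close>; the summand
      1 keeps the denominator positive when \<open>ev h x = 0\<close>.\<close>
    let ?\<delta> = "e / (2 * (\<bar>ev h x\<bar> + 1))"
    have "?\<delta> > 0" using Cons.prems by (simp add: add_nonneg_pos)
    with discontinuous_linear_functional_value_one[OF lin[OF x] V disc[OF xs]] x False
    obtain v where v: "v \<in> ?V" "norm v < ?\<delta>" "ev v x = 1" by blast
    let ?k = "h - ev h x *\<^sub>R v"
    have "\<bar>ev h x\<bar> * norm v \<le> (\<bar>ev h x\<bar> + 1) * ?\<delta>"
      using v(2) by (intro mult_mono) auto
    also have "\<dots> = e / 2" by (simp add: field_simps)
    finally have "norm (ev h x *\<^sub>R v) \<le> e / 2" by simp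
    then have "norm (?k - f) < e"
      using h(1) norm_triangle_ineq4[of "h - f" "ev h x *\<^sub>R v"] by (simp add: algebra_simps)
    moreover have "?k \<in> ?V" using V h(2) v(1) by (intro subspace_diff subspace_scale)
    moreover have "ev ?k x = 0"
      using v(3) by (simp add: linear_diff[OF lin[OF x]] linear_scale[OF lin[OF x]])
    ultimately show ?thesis by (intro exI[of _ ?k]) auto
  qed
qed

text \<open>Adaptivity disappears along zero answers: each query depends only on the earlier
  answers, so just the functionals \<open>L (replicate j 0)\<close> are consulted.\<close>

lemma information_eq_zeros:
  assumes "\<And>j. j < n \<Longrightarrow> L (replicate j 0) f = 0"
  shows "information L n f = replicate n 0"
  using assms by (induction n) (auto simp: replicate_append_same)

lemma algorithms_0: "algorithms \<Lambda> 0 = range (\<lambda>g f. g)"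
  by (auto simp: algorithms_def fun_eq_iff)

lemma const_in_algorithms:
  assumes "\<Lambda> \<noteq> {}"
  shows "(\<lambda>f. g) \<in> algorithms \<Lambda> n"
proof -
  obtain l where "l \<in> \<Lambda>" using assms by auto
  then show ?thesis
    unfolding algorithms_def by (intro CollectI exI[of _ "\<lambda>_. l"] exI[of _ "\<lambda>_. g"]) auto
qed

lemma constant_beats_std_algorithm:
  fixes D :: "'d set"
    and ev :: "'f::real_normed_vector \<Rightarrow> 'd \<Rightarrow> real"
    and S :: "'f \<Rightarrow> 'g::real_normed_vector"
  assumes lin: "\<And>x. x \<in> D \<Longrightarrow> linear (\<lambda>f. ev f x)"
    and S: "continuous_on UNIV S"
    and disc: "\<And>xs x. set xs \<subseteq> D \<Longrightarrow> x \<in> D - set xs \<Longrightarrow>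
           \<not> continuous_on {f. \<forall>y\<in>set xs. ev f y = 0} (\<lambda>f. ev f x)"
    and A: "A \<in> algorithms (std_class D ev) n"
  shows "\<exists>g. worst_case_error S (\<lambda>f. g) \<le> worst_case_error S A"
proof -
  from A obtain L \<phi> where L: "\<And>ys. length ys < n \<Longrightarrow> L ys \<in> std_class D ev"
    and \<phi>: "\<And>f. A f = \<phi> (information L n f)"
    unfolding algorithms_def by blast
  \<comment> \<open>The point queried after \<open>j\<close> zero answers does not depend on the
    input, so one finite list of points serves all \<open>f\<close>.\<close>
  have "\<forall>j. \<exists>x. j < n \<longrightarrow> x \<in> D \<and> L (replicate j 0) = (\<lambda>f. ev f x)"
    using L unfolding std_class_def by (metis imageE length_replicate)
  then obtain p where p: "\<And>j. j < n \<Longrightarrow> p j \<in> D \<and> L (replicate j 0) = (\<lambda>f. ev f (p j))"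
    by metis
  let ?xs = "map p [0..<n]"
  let ?g = "\<phi> (replicate n 0)"
  have xs: "set ?xs \<subseteq> D" using p by auto
  have "ennreal (norm (S f - ?g)) \<le> worst_case_error S A" if f: "norm f < 1" for f
  proof (rule ennreal_le_epsilon)
    fix e :: real assume e: "e > 0"
    from S e obtain d where d: "d > 0" "\<And>h. dist h f < d \<Longrightarrow> dist (S h) (S f) < e"
      unfolding continuous_on_iff by (metis UNIV_I)
    \<comment> \<open>The bound \<open>d\<close> is for continuity of \<open>S\<close> at
      \<open>f\<close>; the bound \<open>1 - norm f\<close> keeps \<open>h\<close> in the open unit
      ball, where the error of \<open>A\<close> is measured.\<close>
    from d(1) f have "min d (1 - norm f) > 0" by simp
    from dense_vanishing_at_points[OF lin disc xs this] obtain h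
      where h: "norm (h - f) < min d (1 - norm f)" "\<forall>y\<in>set ?xs. ev h y = 0" by blast
    have "norm h < 1" using h(1) norm_triangle_sub[of h f] by simp
    have "information L n h = replicate n 0"
      using h(2) p by (intro information_eq_zeros) auto
    then have "A h = ?g" by (simp add: \<phi>)
    have "norm (S f - ?g) \<le> norm (S h - ?g) + e"
      using d(2)[of h] h(1) norm_triangle_ineq[of "S f - S h" "S h - ?g"]
      by (simp add: dist_norm norm_minus_commute)
    then have "ennreal (norm (S f - ?g)) \<le> ennreal (norm (S h - ?g)) + ennreal e"
      using e by (simp flip: ennreal_plus)
    also have "ennreal (norm (S h - ?g)) \<le> worst_case_error S A"
      unfolding worst_case_error_def using \<open>norm h < 1\<close> \<open>A h = ?g\<close>
      by (intro SUP_upper2[of h]) auto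
    finally show "ennreal (norm (S f - ?g)) \<le> worst_case_error S A + ennreal e"
      by (simp add: add_right_mono)
  qed
  then have "worst_case_error S (\<lambda>f. ?g) \<le> worst_case_error S A"
    unfolding worst_case_error_def[of S "\<lambda>f. ?g"] by (intro SUP_least) auto
  then show ?thesis ..
qed

theorem mainTheorem4:
  fixes D :: "'d set"
    and ev :: "'f::real_normed_vector \<Rightarrow> 'd \<Rightarrow> real"
    and S :: "'f \<Rightarrow> 'g::real_normed_vector"
  assumes "D \<noteq> {}"
    and "normed_function_space D ev"
    and "continuous_on UNIV S"
    and "\<And>xs x. set xs \<subseteq> D \<Longrightarrow> x \<in> D - set xs \<Longrightarrow>
           \<not> continuous_on {f. \<forall>y\<in>set xs. ev f y = 0} (\<lambda>f. ev f x)"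
  shows "\<forall>n\<ge>1. e_std D ev n S = e_std D ev 0 S \<and> e_std D ev 0 S = e_all 0 S"
proof (intro allI impI conjI)
  fix n :: nat
  have lin: "\<And>x. x \<in> D \<Longrightarrow> linear (\<lambda>f. ev f x)"
    using assms(2) by (simp add: normed_function_space_def)
  have "std_class D ev \<noteq> {}" using assms(1) by (simp add: std_class_def)
  \<comment> \<open>A constant map is an algorithm that ignores its \<open>n\<close> answers; its
    queries still need a point of \<open>D\<close>.\<close>
  then have "algorithms (std_class D ev) 0 \<subseteq> (algorithms (std_class D ev) n :: ('f \<Rightarrow> 'g) set)"
    by (auto simp: algorithms_0 intro: const_in_algorithms)
  then have "e_std D ev n S \<le> e_std D ev 0 S"
    unfolding e_std_def minimal_error_def by (rule INF_superset_mono) simp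
  moreover have "e_std D ev 0 S \<le> e_std D ev n S"
    unfolding e_std_def minimal_error_def
  proof (rule INF_mono)
    fix A :: "'f \<Rightarrow> 'g" assume "A \<in> algorithms (std_class D ev) n"
    from constant_beats_std_algorithm[OF lin assms(3,4) this]
    show "\<exists>B\<in>algorithms (std_class D ev) 0. worst_case_error S B \<le> worst_case_error S A"
      by (auto simp: algorithms_0)
  qed
  ultimately show "e_std D ev n S = e_std D ev 0 S" by (rule antisym)
  \<comment> \<open>With zero queries both infima run over the same constant maps.\<close>
  show "e_std D ev 0 S = e_all 0 S"
    by (simp add: e_std_def e_all_def minimal_error_def algorithms_0)
qed

end
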